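(* Let $q$ be a prime power and let $\Delta=([\ell],\mathcal{F})$ be a simplicial complex on vertex set $[\ell]$. For a simplicial complex $\Delta'$ on a vertex set $V$, let $\mathcal{S}_{\Delta'}^q$ denote the arrangement in $\mathbb{F}_q^{V}$ (coordinates $x_v$, $v\in V$) $$\mathcal{S}_{\Delta'}^q=\bigcup_{\{i_1,\dots,i_r\}\text{ a nonempty face of }\Delta'}\{\ker(a_{i_1}x_{i_1}+\dots+a_{i_r}x_{i_r})\mid a_{i_j}\in\mathbb{F}_q^\times\text{ for all } j\}.$$ Suppose $e=\{i_1,i_2\}$ is an edge of the underlying graph of $\Delta$ (i.e. a $2$-element face) and that $e$ is a maximal face of $\Delta$. Let $\Delta\setminus e$ be the simplicial complex on $[\ell]$ obtained by removing the face $e$, and let $\Delta/e$ be the simplicial complex on the $(\ell-1)$-element vertex set obtained from $[\ell]$ by identifying $i_1$ and $i_2$, whose faces are the images of the faces of $\Delta$ under this identification. Then $$\chi(\mathcal{S}_\Delta^q,t)=\chi(\mathcal{S}_{\Delta\setminus e}^q,t)-(q-1)\,\chi(\mathcal{S}_{\Delta/e}^q,t).$$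
   Context: A simplicial complex $(V,\mathcal{F})$ has face set $\mathcal{F}\subseteq 2^V$ closed under subsets, every vertex being a face. Its underlying graph has the $2$-element faces as edges. For a central arrangement $\mathcal{A}$ in $\mathbb{K}^n$, $\chi(\mathcal{A},t)=\sum_{\mathcal{B}\subseteq\mathcal{A}}(-1)^{|\mathcal{B}|}t^{\dim\bigcap_{H\in\mathcal{B}}H}$, with the empty intersection equal to $\mathbb{K}^n$. *)

theory Defs
  imports
    "HOL-Library.Function_Algebras"
    "HOL-Library.Cardinality"
    "HOL-Computational_Algebra.Polynomial"
    "HOL-Number_Theory.Prime_Powers"
begin

section \<open>Simplicial complexes\<close>

definition simplicial_complex :: "'v set \<Rightarrow> 'v set set \<Rightarrow> bool" where
  "simplicial_complex V F \<longleftrightarrow>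
     F \<subseteq> Pow V \<and> (\<forall>f\<in>F. \<forall>g. g \<subseteq> f \<longrightarrow> g \<in> F) \<and> (\<forall>v\<in>V. {v} \<in> F)"

definition underlying_edges :: "'v set set \<Rightarrow> 'v set set" where
  "underlying_edges F = {e \<in> F. card e = 2}"

definition maximal_face :: "'v set set \<Rightarrow> 'v set \<Rightarrow> bool" where
  "maximal_face F e \<longleftrightarrow> e \<in> F \<and> (\<forall>f\<in>F. e \<subseteq> f \<longrightarrow> f = e)"

definition delete_face :: "'v set set \<Rightarrow> 'v set \<Rightarrow> 'v set set" where
  "delete_face F e = F - {e}"

text \<open>The vertex set obtained from \<open>V\<close> by identifying \<open>i1\<close> and \<open>i2\<close> is modelled as
  \<open>identify i1 i2 ` V\<close>, where \<open>i1\<close> represents the merged vertex.\<close>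

definition identify :: "'v \<Rightarrow> 'v \<Rightarrow> 'v \<Rightarrow> 'v" where
  "identify i1 i2 v = (if v = i2 then i1 else v)"

definition contract_faces :: "'v \<Rightarrow> 'v \<Rightarrow> 'v set set \<Rightarrow> 'v set set" where
  "contract_faces i1 i2 F = (\<lambda>f. identify i1 i2 ` f) ` F"

lemma simplicial_complex_delete_face:
  assumes "simplicial_complex V F" "maximal_face F e" "e \<in> underlying_edges F"
  shows "simplicial_complex V (delete_face F e)"
proof -
  have "card e = 2" using assms(3) by (simp add: underlying_edges_def)
  then have ne: "e \<noteq> {v}" for v by auto
  show ?thesis
    unfolding simplicial_complex_def
  proof (intro conjI ballI allI impI)
    show "delete_face F e \<subseteq> Pow V"
      using assms(1) by (auto simp: simplicial_complex_def delete_face_def)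
  next
    fix f g assume f: "f \<in> delete_face F e" and g: "g \<subseteq> f"
    have "f \<in> F" "f \<noteq> e" using f by (auto simp: delete_face_def)
    moreover have "g \<in> F"
      using assms(1) g \<open>f \<in> F\<close> by (simp add: simplicial_complex_def)
    moreover have "g \<noteq> e"
      using assms(2) g \<open>f \<in> F\<close> \<open>f \<noteq> e\<close> by (auto simp: maximal_face_def)
    ultimately show "g \<in> delete_face F e" by (simp add: delete_face_def)
  next
    fix v assume "v \<in> V"
    then show "{v} \<in> delete_face F e"
      using assms(1) ne[of v] by (auto simp: simplicial_complex_def delete_face_def)
  qed
qed

lemma simplicial_complex_contract_faces:
  assumes "simplicial_complex V F"
  shows "simplicial_complex (identify i1 i2 ` V) (contract_faces i1 i2 F)"
  unfolding simplicial_complex_def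
proof (intro conjI ballI allI impI)
  show "contract_faces i1 i2 F \<subseteq> Pow (identify i1 i2 ` V)"
    using assms unfolding simplicial_complex_def contract_faces_def by blast
next
  fix f g assume "f \<in> contract_faces i1 i2 F" "g \<subseteq> f"
  then obtain h where h: "h \<in> F" "g \<subseteq> identify i1 i2 ` h"
    unfolding contract_faces_def by blast
  then obtain k where k: "k \<subseteq> h" "g = identify i1 i2 ` k"
    by (meson subset_imageE)
  then have "k \<in> F" using assms h(1) by (simp add: simplicial_complex_def)
  then show "g \<in> contract_faces i1 i2 F"
    unfolding contract_faces_def k(2) by (rule imageI)
next
  fix v assume "v \<in> identify i1 i2 ` V"
  then obtain w where "w \<in> V" "v = identify i1 i2 w" by blast
  then have "{w} \<in> F" "{v} = identify i1 i2 ` {w}"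
    using assms by (auto simp: simplicial_complex_def)
  then show "{v} \<in> contract_faces i1 i2 F"
    unfolding contract_faces_def by blast
qed

lemma card_identify:
  assumes "finite V" "i1 \<in> V" "i2 \<in> V" "i1 \<noteq> i2"
  shows "card (identify i1 i2 ` V) = card V - 1"
proof -
  have "identify i1 i2 ` V = V - {i2}"
    using assms by (auto simp: identify_def)
  then show ?thesis using assms by simp
qed

section \<open>Arrangements in a coordinate space\<close>

text \<open>The coordinate space indexed by \<open>V\<close> is modelled by the functions vanishing outside \<open>V\<close>,
  so that dimensions can be taken in the vector space of all functions.\<close>

definition coord_space :: "'v set \<Rightarrow> ('v \<Rightarrow> 'k::field) set" where
  "coord_space V = {x. \<forall>v. v \<notin> V \<longrightarrow> x v = 0}"

definition fun_scale :: "'k::field \<Rightarrow> ('v \<Rightarrow> 'k) \<Rightarrow> 'v \<Rightarrow> 'k" where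
  "fun_scale c x = (\<lambda>v. c * x v)"

lemma vector_space_fun_scale: "vector_space (fun_scale :: 'k::field \<Rightarrow> ('v \<Rightarrow> 'k) \<Rightarrow> 'v \<Rightarrow> 'k)"
  by unfold_locales (auto simp: fun_scale_def fun_eq_iff algebra_simps)

abbreviation fun_dim :: "('v \<Rightarrow> 'k::field) set \<Rightarrow> nat" where
  "fun_dim \<equiv> vector_space.dim fun_scale"

text \<open>Intersecting with \<open>coord_space V\<close> makes the empty intersection the whole space.\<close>

definition arr_char_poly :: "'v set \<Rightarrow> ('v \<Rightarrow> 'k::field) set set \<Rightarrow> int poly" where
  "arr_char_poly V A =
     (\<Sum>B\<in>Pow A. monom ((-1) ^ card B) (fun_dim (coord_space V \<inter> \<Inter>B)))"

definition lin_kernel :: "'v set \<Rightarrow> 'v set \<Rightarrow> ('v \<Rightarrow> 'k::field) \<Rightarrow> ('v \<Rightarrow> 'k) set" where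
  "lin_kernel V f a = {x \<in> coord_space V. (\<Sum>i\<in>f. a i * x i) = 0}"

definition complex_arrangement :: "'v set \<Rightarrow> 'v set set \<Rightarrow> ('v \<Rightarrow> 'k::field) set set" where
  "complex_arrangement V F =
     (\<Union>f\<in>F - {{}}. {lin_kernel V f a |a. \<forall>i\<in>f. a i \<noteq> 0})"

text \<open>The type argument selects the coefficient field.\<close>

definition complex_char_poly :: "'k::field itself \<Rightarrow> 'v set \<Rightarrow> 'v set set \<Rightarrow> int poly" where
  "complex_char_poly K V F =
     arr_char_poly V (complex_arrangement V F :: ('v \<Rightarrow> 'k) set set)"

end

theory Submission
  imports Defs "HOL-Library.FuncSet"
begin

text \<open>
  Over a field with \<open>q\<close> elements, inclusion-exclusion shows that the characteristic polynomial of an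
  arrangement takes at \<open>q ^ m\<close> the number of \<open>m\<close>-tuples of points not contained in any single
  hyperplane. Reading the tuple as a matrix and looking at it column by column, such a tuple for the
  arrangement of a complex becomes a colouring of the vertices by vectors in an \<open>m\<close>-dimensional
  space \<open>W\<close>, where no face carries a vanishing linear combination with all coefficients non-zero.

  These colourings behave like the proper colourings of a graph. A colouring of the complex without
  \<open>{i1, i2}\<close> fails for the whole complex exactly when \<open>y i2 = c *s y i1\<close> for some \<open>c \<noteq> 0\<close>. This \<open>c\<close> is
  unique since \<open>y i1 \<noteq> 0\<close>, and dropping the colour of \<open>i2\<close> leaves a colouring of the contraction: by
  maximality no remaining face contains both ends, so identifying them rescales at most one vector
  of each face. Thus the two sides agree at all powers of \<open>q\<close>.
\<close>

section \<open>Colourings of a complex by vectors\<close>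

locale colour_space =
  vector_space scale
  for scale :: "'a::field \<Rightarrow> 'b::ab_group_add \<Rightarrow> 'b" (infixr \<open>*s\<close> 75) +
  fixes W :: "'b set"
  assumes subspace_colours: "subspace W"
begin

definition proper_on :: "('v \<Rightarrow> 'b) \<Rightarrow> 'v set \<Rightarrow> bool" where
  "proper_on y f \<longleftrightarrow> (\<forall>a. (\<forall>i\<in>f. a i \<noteq> 0) \<longrightarrow> (\<Sum>i\<in>f. a i *s y i) \<noteq> 0)"

definition colourings :: "'v set \<Rightarrow> 'v set set \<Rightarrow> ('v \<Rightarrow> 'b) set" where
  "colourings V F = {y \<in> V \<rightarrow>\<^sub>E W. \<forall>f\<in>F - {{}}. proper_on y f}"

lemma proper_on_singleton: "proper_on y {i} \<longleftrightarrow> y i \<noteq> 0"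
proof
  assume "proper_on y {i}"
  then show "y i \<noteq> 0"
    unfolding proper_on_def by (elim allE[of _ "\<lambda>_. 1"]) simp
qed (simp add: proper_on_def)

lemma proper_on_pair:
  assumes "i \<noteq> j"
  shows "proper_on y {i, j} \<longleftrightarrow> (\<forall>c. c \<noteq> 0 \<longrightarrow> y j \<noteq> c *s y i)"
proof
  assume proper: "proper_on y {i, j}"
  show "\<forall>c. c \<noteq> 0 \<longrightarrow> y j \<noteq> c *s y i"
  proof (intro allI impI)
    fix c :: 'a assume "c \<noteq> 0"
    define a where "a k = (if k = i then c else - 1)" for k
    have "\<forall>k\<in>{i, j}. a k \<noteq> 0"
      using \<open>c \<noteq> 0\<close> by (simp add: a_def)
    then have "(\<Sum>k\<in>{i, j}. a k *s y k) \<noteq> 0"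
      using proper unfolding proper_on_def by blast
    then show "y j \<noteq> c *s y i"
      using assms by (auto simp: a_def)
  qed
next
  assume not_multiple: "\<forall>c. c \<noteq> 0 \<longrightarrow> y j \<noteq> c *s y i"
  have "a i *s y i + a j *s y j \<noteq> 0" if "a i \<noteq> 0" "a j \<noteq> 0" for a
  proof
    assume "a i *s y i + a j *s y j = 0"
    then have "a j *s y j = a j *s ((- a i / a j) *s y i)"
      using \<open>a j \<noteq> 0\<close> by (simp add: eq_neg_iff_add_eq_0 add.commute)
    then have "y j = (- a i / a j) *s y i"
      using \<open>a j \<noteq> 0\<close> by (simp only: scale_left_imp_eq)
    then show False
      using not_multiple that by (auto simp del: scale_minus_left)
  qed
  then show "proper_on y {i, j}"
    using assms by (simp add: proper_on_def)
qed

lemma proper_on_image: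
  assumes "inj_on p f"
  shows "proper_on z (p ` f) \<longleftrightarrow> proper_on (z \<circ> p) f"
proof
  assume proper: "proper_on z (p ` f)"
  show "proper_on (z \<circ> p) f"
    unfolding proper_on_def
  proof (intro allI impI)
    fix a :: "_ \<Rightarrow> 'a" assume "\<forall>i\<in>f. a i \<noteq> 0"
    then have "(\<Sum>k\<in>p ` f. a (inv_into f p k) *s z k) \<noteq> 0"
      using proper assms by (auto simp: proper_on_def)
    then show "(\<Sum>i\<in>f. a i *s (z \<circ> p) i) \<noteq> 0"
      using assms by (simp add: sum.reindex)
  qed
next
  assume proper: "proper_on (z \<circ> p) f"
  show "proper_on z (p ` f)"
    unfolding proper_on_def
  proof (intro allI impI)
    fix a :: "_ \<Rightarrow> 'a" assume "\<forall>k\<in>p ` f. a k \<noteq> 0"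
    then have "(\<Sum>i\<in>f. (a \<circ> p) i *s (z \<circ> p) i) \<noteq> 0"
      using proper unfolding proper_on_def by (metis comp_apply imageI)
    then show "(\<Sum>k\<in>p ` f. a k *s z k) \<noteq> 0"
      using assms by (simp add: sum.reindex)
  qed
qed

lemma proper_on_scale:
  assumes "\<And>i. i \<in> f \<Longrightarrow> w i \<noteq> 0" and "\<And>i. i \<in> f \<Longrightarrow> y i = w i *s z i"
  shows "proper_on y f \<longleftrightarrow> proper_on z f"
proof -
  have proper_onI: "proper_on y f"
    if "proper_on z f" "\<And>i. i \<in> f \<Longrightarrow> w i \<noteq> 0 \<and> y i = w i *s z i" for w y z
    unfolding proper_on_def
  proof (intro allI impI)
    fix a :: "_ \<Rightarrow> 'a" assume "\<forall>i\<in>f. a i \<noteq> 0"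
    then have "(\<Sum>i\<in>f. (a i * w i) *s z i) \<noteq> 0"
      using that by (simp add: proper_on_def)
    then show "(\<Sum>i\<in>f. a i *s y i) \<noteq> 0"
      using that by simp
  qed
  have "z i = inverse (w i) *s y i" if "i \<in> f" for i
    using assms that by simp
  then show ?thesis
    using assms proper_onI[of z w y] proper_onI[of y "\<lambda>i. inverse (w i)" z] by auto
qed

lemma colourings_nonzero:
  assumes "y \<in> colourings V F" and "{i} \<in> F"
  shows "y i \<noteq> 0"
  using assms by (auto simp: colourings_def proper_on_singleton[symmetric])

end

section \<open>Deletion and contraction of a maximal edge\<close>

locale maximal_edge =
  fixes V :: "'v set" and F :: "'v set set" and i1 i2 :: 'v
  assumes finite_vertices: "finite V"
    and complex: "simplicial_complex V F"
    and ends_distinct: "i1 \<noteq> i2"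
    and maximal: "maximal_face F {i1, i2}"
begin

abbreviation deleted :: "'v set set" where "deleted \<equiv> delete_face F {i1, i2}"

abbreviation contracted :: "'v set set" where "contracted \<equiv> contract_faces i1 i2 F"

lemma edge_in: "{i1, i2} \<in> F"
  using maximal by (simp add: maximal_face_def)

lemma ends_in: "i1 \<in> V" "i2 \<in> V"
  using edge_in complex by (auto simp: simplicial_complex_def)

lemma singleton_in_deleted: "{i1} \<in> deleted"
  using complex ends_in ends_distinct by (auto simp: simplicial_complex_def delete_face_def)

lemma singleton_in_contracted: "{i1} \<in> contracted"
proof -
  have "identify i1 i2 ` {i1} = {i1}" and "{i1} \<in> F"
    using singleton_in_deleted by (auto simp: identify_def delete_face_def)
  then show ?thesis
    unfolding contract_faces_def by (metis imageI)
qed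

lemma identify_vertices: "identify i1 i2 ` V = V - {i2}"
  using ends_in ends_distinct by (auto simp: identify_def)

lemma inj_on_identify:
  assumes "f \<in> deleted"
  shows "inj_on (identify i1 i2) f"
proof -
  have "\<not> {i1, i2} \<subseteq> f"
    using assms maximal by (auto simp: maximal_face_def delete_face_def)
  then show ?thesis by (auto simp: inj_on_def identify_def)
qed

lemma contract_faces_deleted: "contract_faces i1 i2 deleted = contracted"
proof -
  have "identify i1 i2 ` {i1, i2} = identify i1 i2 ` {i1}"
    by (auto simp: identify_def)
  then have "identify i1 i2 ` {i1, i2} \<in> contract_faces i1 i2 deleted"
    unfolding contract_faces_def using singleton_in_deleted by (simp only: imageI)
  moreover have "F = insert {i1, i2} deleted"
    using edge_in by (auto simp: delete_face_def)
  ultimately show ?thesis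
    unfolding contract_faces_def by (metis image_insert insert_absorb)
qed

end

locale maximal_edge_colouring =
  colour_space scale W + maximal_edge V F i1 i2
  for scale :: "'a::field \<Rightarrow> 'b::ab_group_add \<Rightarrow> 'b" (infixr \<open>*s\<close> 75)
    and W :: "'b set" and V :: "'v set" and F i1 i2
begin

abbreviation extend_colouring :: "'a \<Rightarrow> ('v \<Rightarrow> 'b) \<Rightarrow> 'v \<Rightarrow> 'b" where
  "extend_colouring c z \<equiv> z(i2 := c *s z i1)"

lemma colourings_subset_deleted: "colourings V F \<subseteq> colourings V deleted"
  by (auto simp: colourings_def delete_face_def)

lemma colourings_deleted_Diff:
  "colourings V deleted - colourings V F =
     {y \<in> colourings V deleted. \<exists>c. c \<noteq> 0 \<and> y i2 = c *s y i1}"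
proof -
  have "y \<in> colourings V F \<longleftrightarrow>
      y \<in> colourings V deleted \<and> proper_on y {i1, i2}" for y
    using edge_in by (auto simp: colourings_def delete_face_def)
  then show ?thesis
    by (auto simp: proper_on_pair ends_distinct)
qed

lemma proper_on_extend_colouring:
  assumes "c \<noteq> 0" and "f \<in> deleted"
  shows "proper_on (extend_colouring c z) f \<longleftrightarrow> proper_on z (identify i1 i2 ` f)"
proof -
  have "proper_on (extend_colouring c z) f \<longleftrightarrow> proper_on (z \<circ> identify i1 i2) f"
    using assms(1) by (intro proper_on_scale[of f "\<lambda>i. if i = i2 then c else 1"])
      (auto simp: identify_def)
  then show ?thesis
    by (simp add: proper_on_image inj_on_identify assms(2))
qed

lemma extend_colouring_in_colourings_iff:
  assumes "c \<noteq> 0" and "z \<in> extensional (V - {i2})"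
  shows "extend_colouring c z \<in> colourings V deleted \<longleftrightarrow>
    z \<in> colourings (V - {i2}) contracted"
proof -
  have "extend_colouring c z \<in> V \<rightarrow>\<^sub>E W \<longleftrightarrow> z \<in> (V - {i2}) \<rightarrow>\<^sub>E W"
    using assms(2) ends_in ends_distinct subspace_scale[OF subspace_colours]
    by (auto simp: PiE_iff extensional_def)
  moreover have "(\<forall>f\<in>deleted - {{}}. proper_on (extend_colouring c z) f) \<longleftrightarrow>
      (\<forall>f\<in>contract_faces i1 i2 deleted - {{}}. proper_on z f)"
    using proper_on_extend_colouring[OF assms(1)] by (auto simp: contract_faces_def)
  ultimately show ?thesis
    by (simp add: colourings_def contract_faces_deleted)
qed

lemma inj_on_extend_colouring:
  "inj_on (\<lambda>(c, z). extend_colouring c z)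
     ((- {0}) \<times> colourings (V - {i2}) contracted)"
proof -
  have "c = d \<and> z = x"
    if z_colouring: "z \<in> colourings (V - {i2}) contracted"
      and x_colouring: "x \<in> colourings (V - {i2}) contracted"
      and extend_eq: "extend_colouring c z = extend_colouring d x" for c d z x
  proof -
    have "z i2 = x i2"
      using z_colouring x_colouring by (auto simp: colourings_def PiE_iff extensional_def)
    then have "z = x"
      using extend_eq by (metis fun_upd_triv fun_upd_upd)
    moreover have "z i1 \<noteq> 0"
      using z_colouring singleton_in_contracted by (rule colourings_nonzero)
    moreover have "c *s z i1 = d *s x i1"
      using fun_cong[OF extend_eq, of i2] by simp
    ultimately show ?thesis by simp
  qed
  then show ?thesis by (simp add: inj_on_def split_paired_Ball_Sigma)
qed

lemma image_extend_colouring: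
  "(\<lambda>(c, z). extend_colouring c z) ` ((- {0}) \<times> colourings (V - {i2}) contracted) =
     colourings V deleted - colourings V F"
  (is "?extend ` ?contracted = ?improper")
proof (intro equalityI subsetI)
  fix y assume "y \<in> ?extend ` ?contracted"
  then obtain c z where c_nonzero: "c \<noteq> 0" and y_eq: "y = extend_colouring c z"
    and z_colouring: "z \<in> colourings (V - {i2}) contracted"
    by auto
  have "z \<in> extensional (V - {i2})"
    using z_colouring by (simp add: colourings_def PiE_iff)
  then have "y \<in> colourings V deleted"
    using c_nonzero z_colouring y_eq extend_colouring_in_colourings_iff by simp
  moreover have "y i2 = c *s y i1"
    using ends_distinct by (simp add: y_eq)
  ultimately show "y \<in> ?improper"
    using c_nonzero by (auto simp: colourings_deleted_Diff)
next
  fix y assume "y \<in> ?improper"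
  then obtain c where c_nonzero: "c \<noteq> 0" and y_i2: "y i2 = c *s y i1"
    and y_colouring: "y \<in> colourings V deleted"
    by (auto simp: colourings_deleted_Diff)
  define z where "z = y(i2 := undefined)"
  have extend_z: "extend_colouring c z = y"
    using ends_distinct by (simp add: z_def flip: y_i2)
  have "z \<in> extensional (V - {i2})"
    using y_colouring by (auto simp: z_def colourings_def PiE_iff extensional_def)
  then have "z \<in> colourings (V - {i2}) contracted"
    using y_colouring c_nonzero extend_z extend_colouring_in_colourings_iff by metis
  then show "y \<in> ?extend ` ?contracted"
    using c_nonzero extend_z by (intro image_eqI[of _ _ "(c, z)"]) auto
qed

lemma card_colourings_deleted:
  assumes "finite W"
  shows "card (colourings V deleted) =
    card (colourings V F) + (CARD('a) - 1) * card (colourings (identify i1 i2 ` V) contracted)"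
proof -
  have "finite (colourings V deleted)"
    unfolding colourings_def
    by (rule finite_subset[OF Collect_restrict]) (simp add: finite_PiE finite_vertices assms)
  then have "card (colourings V deleted) =
      card (colourings V F) + card (colourings V deleted - colourings V F)"
    using colourings_subset_deleted
    by (metis card_Diff_subset card_mono finite_subset le_add_diff_inverse)
  also have "card (colourings V deleted - colourings V F) =
      card ((- {0 :: 'a}) \<times> colourings (V - {i2}) contracted)"
    unfolding image_extend_colouring[symmetric]
    by (rule card_image[OF inj_on_extend_colouring])
  also have "\<dots> = (CARD('a) - 1) * card (colourings (V - {i2}) contracted)"
    unfolding Compl_eq_Diff_UNIV by (simp only: card_cartesian_product card_Diff_singleton UNIV_I)
  finally show ?thesis
    by (simp add: identify_vertices)
qed

end

section \<open>Counting points of an arrangement over a finite field\<close>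

lemma poly_eqI_infinite:
  fixes p r :: "'a::idom poly"
  assumes "infinite S" and "\<And>x. x \<in> S \<Longrightarrow> poly p x = poly r x"
  shows "p = r"
proof (rule ccontr)
  assume "p \<noteq> r"
  then have "finite {x. poly (p - r) x = 0}" by (intro poly_roots_finite) simp
  moreover have "S \<subseteq> {x. poly (p - r) x = 0}" using assms(2) by auto
  ultimately show False using assms(1) finite_subset by blast
qed

lemma card_Diff_UN_inclusion_exclusion:
  assumes "finite T" and "finite A"
  shows "int (card (T - (\<Union>H\<in>A. G H))) =
    (\<Sum>B\<in>Pow A. (-1) ^ card B * int (card (T \<inter> (\<Inter>H\<in>B. G H))))"
proof -
  let ?card_in_T = "\<lambda>X. int (card (T \<inter> X))"
  have "?card_in_T (\<Union>H\<in>A. G H) = (\<Sum>B | B \<subseteq> A \<and> B \<noteq> {}. (-1) ^ (card B + 1) * ?card_in_T (\<Inter>H\<in>B. G H))"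
  proof (rule Incl_Excl_UN[OF _ assms(2)])
    show "?card_in_T (X \<union> Y) = ?card_in_T X + ?card_in_T Y" if "disjnt X Y" for X Y
      using that assms(1)
      by (auto simp: Int_Un_distrib disjnt_def intro!: card_Un_disjoint simp flip: of_nat_add)
  qed
  moreover have "Pow A = insert {} {B. B \<subseteq> A \<and> B \<noteq> {}}" by auto
  moreover have "int (card (T - (\<Union>H\<in>A. G H))) = int (card T) - ?card_in_T (\<Union>H\<in>A. G H)"
    using assms(1) by (simp add: card_Diff_subset_Int card_mono of_nat_diff)
  ultimately show ?thesis
    using assms(2) by (simp add: sum_negf)
qed

lemma (in vector_space) card_span_independent:
  assumes "finite B" and "independent B"
  shows "card (span B) = CARD('a) ^ card B"
proof -
  let ?lincomb = "\<lambda>u. \<Sum>b\<in>B. u b *s b"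
  have "inj_on ?lincomb (B \<rightarrow>\<^sub>E UNIV)"
  proof (rule inj_onI)
    fix u v assume u_PiE: "u \<in> B \<rightarrow>\<^sub>E UNIV" and v_PiE: "v \<in> B \<rightarrow>\<^sub>E UNIV"
      and "?lincomb u = ?lincomb v"
    then have "(\<Sum>b\<in>B. (u b - v b) *s b) = 0"
      by (simp add: scale_left_diff_distrib sum_subtractf)
    then have "u b - v b = 0" if "b \<in> B" for b
      using independentD[OF assms(2,1) order_refl, of "\<lambda>b. u b - v b"] that by blast
    then show "u = v"
      using u_PiE v_PiE by (intro PiE_ext) auto
  qed
  moreover have "span B = ?lincomb ` (B \<rightarrow>\<^sub>E UNIV)"
  proof -
    have "?lincomb u \<in> ?lincomb ` (B \<rightarrow>\<^sub>E UNIV)" for u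
      by (rule image_eqI[of _ _ "restrict u B"]) auto
    then show ?thesis
      unfolding span_finite[OF assms(1)] by blast
  qed
  ultimately show ?thesis
    using assms(1) by (simp add: card_image card_PiE)
qed

lemma (in vector_space) card_subspace:
  assumes "subspace X" and "finite X"
  shows "card X = CARD('a) ^ dim X"
proof -
  obtain B where basis: "B \<subseteq> X" "independent B" "X \<subseteq> span B" "card B = dim X"
    using basis_exists by blast
  have "span B = X"
    using basis assms(1) by (simp add: span_minimal equalityI)
  then show ?thesis
    using card_span_independent[of B] basis assms(2) finite_subset by metis
qed

interpretation fun_vs: vector_space "fun_scale :: 'k::field \<Rightarrow> ('v \<Rightarrow> 'k) \<Rightarrow> 'v \<Rightarrow> 'k"
  by (rule vector_space_fun_scale)

lemma subspace_coord_space: "fun_vs.subspace (coord_space V)"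
  by (auto simp: fun_vs.subspace_def coord_space_def fun_scale_def)

lemma subspace_lin_kernel: "fun_vs.subspace (lin_kernel V f a)"
proof -
  have "(\<Sum>i\<in>f. a i * (c * x i)) = c * (\<Sum>i\<in>f. a i * x i)" for c x
    by (simp add: sum_distrib_left algebra_simps)
  then show ?thesis
    using subspace_coord_space[of V]
    by (auto simp: fun_vs.subspace_def lin_kernel_def fun_scale_def distrib_left sum.distrib)
qed

lemma finite_coord_space:
  assumes "finite V"
  shows "finite (coord_space V :: ('v \<Rightarrow> 'k::{field,finite}) set)"
  by (rule finite_subset[OF _ finite_set_of_finite_funs[where B = UNIV and d = 0, OF assms finite]])
    (auto simp: coord_space_def)

lemma finite_complex_arrangement:
  assumes "finite V"
  shows "finite (complex_arrangement V F :: ('v \<Rightarrow> 'k::{field,finite}) set set)"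
proof -
  have "complex_arrangement V F \<subseteq> Pow (coord_space V :: ('v \<Rightarrow> 'k) set)"
    by (auto simp: complex_arrangement_def lin_kernel_def)
  then show ?thesis
    using finite_coord_space[OF assms] finite_subset by blast
qed

text \<open>The critical theorem of Crapo and Rota.\<close>

lemma poly_arr_char_poly_card_power:
  fixes A :: "('v \<Rightarrow> 'k::{field,finite}) set set" and J :: "'j set"
  assumes "finite V" and "finite A" and "\<And>H. H \<in> A \<Longrightarrow> fun_vs.subspace H" and "finite J"
  shows "poly (arr_char_poly V A) (int (CARD('k) ^ card J)) =
    int (card ((J \<rightarrow>\<^sub>E coord_space V) - (\<Union>H\<in>A. J \<rightarrow> H)))"
proof -
  let ?X = "\<lambda>B. coord_space V \<inter> \<Inter>B"
  have "int (CARD('k) ^ card J) ^ fun_dim (?X B) =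
      int (card ((J \<rightarrow>\<^sub>E coord_space V) \<inter> (\<Inter>H\<in>B. J \<rightarrow> H)))" if "B \<subseteq> A" for B
  proof -
    have "(J \<rightarrow>\<^sub>E coord_space V) \<inter> (\<Inter>H\<in>B. J \<rightarrow> H) = J \<rightarrow>\<^sub>E ?X B"
      by (auto simp: PiE_iff)
    moreover have "card (?X B) = CARD('k) ^ fun_dim (?X B)"
      using that assms(1,3)
      by (intro fun_vs.card_subspace fun_vs.subspace_inter fun_vs.subspace_Inter)
        (auto simp: subspace_coord_space finite_coord_space)
    ultimately show ?thesis
      using assms(4) by (simp add: card_PiE mult.commute flip: power_mult)
  qed
  then show ?thesis
    using assms(1,2,4)
    by (simp add: arr_char_poly_def poly_sum poly_monom card_Diff_UN_inclusion_exclusion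
        finite_PiE finite_coord_space)
qed

section \<open>Tuples of points as colourings\<close>

definition transposed :: "'i set \<Rightarrow> 'j set \<Rightarrow> ('i \<Rightarrow> 'j \<Rightarrow> 'k::zero) \<Rightarrow> 'j \<Rightarrow> 'i \<Rightarrow> 'k" where
  "transposed I J t = (\<lambda>j\<in>J. \<lambda>i. if i \<in> I then t i j else 0)"

lemma transposed_in_PiE: "transposed I J t \<in> J \<rightarrow>\<^sub>E coord_space I"
  by (auto simp: transposed_def coord_space_def)

lemma transposed_transposed:
  assumes "t \<in> I \<rightarrow>\<^sub>E coord_space J"
  shows "transposed J I (transposed I J t) = t"
  using assms by (intro PiE_ext[OF transposed_in_PiE])
    (auto simp: transposed_def coord_space_def fun_eq_iff PiE_iff)

lemma bij_betw_transposed: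
  "bij_betw (transposed I J) (I \<rightarrow>\<^sub>E coord_space J) (J \<rightarrow>\<^sub>E coord_space I)"
  by (intro bij_betwI[where g = "transposed J I"] Pi_I transposed_in_PiE transposed_transposed)

interpretation coord_colours: colour_space fun_scale "coord_space J :: ('j \<Rightarrow> 'k::field) set" for J
  by unfold_locales (rule subspace_coord_space)

lemma sum_fun_apply: "(\<Sum>i\<in>f. g i) x = (\<Sum>i\<in>f. g i x)"
  by (induction f rule: infinite_finite_induct) auto

lemma proper_on_transposed_iff:
  fixes t :: "'j \<Rightarrow> 'v \<Rightarrow> 'k::field"
  assumes "t \<in> J \<rightarrow>\<^sub>E coord_space V" and "f \<subseteq> V"
  shows "coord_colours.proper_on (transposed J V t) f \<longleftrightarrow>
    (\<forall>a. (\<forall>i\<in>f. a i \<noteq> 0) \<longrightarrow> t \<notin> J \<rightarrow> lin_kernel V f a)"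
proof -
  have "(\<Sum>i\<in>f. fun_scale (a i) (transposed J V t i)) = 0 \<longleftrightarrow> t \<in> J \<rightarrow> lin_kernel V f a" for a
  proof -
    have "(\<Sum>i\<in>f. fun_scale (a i) (transposed J V t i)) j =
        (if j \<in> J then \<Sum>i\<in>f. a i * t j i else 0)" for j
      using assms(2)
      by (auto simp: sum_fun_apply fun_scale_def transposed_def subset_iff
          intro: sum.neutral sum.cong)
    then show ?thesis
      using assms(1) by (auto simp: fun_eq_iff lin_kernel_def)
  qed
  then show ?thesis
    by (simp add: coord_colours.proper_on_def)
qed

lemma bij_betw_transposed_colourings:
  assumes "F \<subseteq> Pow V"
  shows "bij_betw (transposed J V)
    ((J \<rightarrow>\<^sub>E coord_space V) - (\<Union>H\<in>complex_arrangement V F. J \<rightarrow> H))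
    (coord_colours.colourings J V F :: ('v \<Rightarrow> 'j \<Rightarrow> 'k::field) set)"
proof -
  have "(\<forall>f\<in>F - {{}}. coord_colours.proper_on (transposed J V t) f) \<longleftrightarrow>
      t \<notin> (\<Union>H\<in>complex_arrangement V F. J \<rightarrow> H)"
    if "t \<in> J \<rightarrow>\<^sub>E coord_space V" for t :: "'j \<Rightarrow> 'v \<Rightarrow> 'k"
  proof -
    have "(\<forall>f\<in>F - {{}}. coord_colours.proper_on (transposed J V t) f) \<longleftrightarrow>
        (\<forall>f\<in>F - {{}}. \<forall>a. (\<forall>i\<in>f. a i \<noteq> 0) \<longrightarrow> t \<notin> J \<rightarrow> lin_kernel V f a)"
      using proper_on_transposed_iff[OF that] assms by (intro ball_cong) auto
    then show ?thesis
      unfolding complex_arrangement_def by blast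
  qed
  then show ?thesis
    unfolding coord_colours.colourings_def set_diff_eq
    by (rule bij_betw_Collect[OF bij_betw_transposed])
qed

lemma poly_complex_char_poly_eq_card_colourings:
  fixes J :: "'j set"
  assumes "finite V" and "simplicial_complex V F" and "finite J"
  shows "poly (complex_char_poly TYPE('k::{field,finite}) V F) (int (CARD('k) ^ card J)) =
    int (card (coord_colours.colourings J V F :: ('v \<Rightarrow> 'j \<Rightarrow> 'k) set))"
proof -
  let ?A = "complex_arrangement V F :: ('v \<Rightarrow> 'k) set set"
  have "fun_vs.subspace H" if "H \<in> ?A" for H
    using that by (auto simp: complex_arrangement_def subspace_lin_kernel)
  then have "poly (arr_char_poly V ?A) (int (CARD('k) ^ card J)) =
      int (card ((J \<rightarrow>\<^sub>E coord_space V) - (\<Union>H\<in>?A. J \<rightarrow> H)))"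
    using assms(1,3) finite_complex_arrangement by (intro poly_arr_char_poly_card_power)
  moreover have "F \<subseteq> Pow V"
    using assms(2) by (simp add: simplicial_complex_def)
  ultimately show ?thesis
    using bij_betw_same_card[OF bij_betw_transposed_colourings] by (metis complex_char_poly_def)
qed

section \<open>Deletion-contraction\<close>

context maximal_edge
begin

lemma poly_deletion_contraction:
  fixes m :: nat
  defines "x \<equiv> int (CARD('k::{field,finite}) ^ m)"
  shows "poly (complex_char_poly TYPE('k) V F) x =
    poly (complex_char_poly TYPE('k) V deleted) x
    - (int (CARD('k)) - 1) *
        poly (complex_char_poly TYPE('k) (identify i1 i2 ` V) contracted) x"
proof -
  have "{i1, i2} \<in> underlying_edges F"
    using edge_in ends_distinct by (simp add: underlying_edges_def)
  then have complex_deleted: "simplicial_complex V deleted"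
    by (rule simplicial_complex_delete_face[OF complex maximal])
  have poly_eq_card: "poly (complex_char_poly TYPE('k) U G) x =
      int (card (coord_colours.colourings {..<m} U G :: ('v \<Rightarrow> nat \<Rightarrow> 'k) set))"
    if "finite U" "simplicial_complex U G" for U :: "'v set" and G
    using poly_complex_char_poly_eq_card_colourings[OF that finite_lessThan[of m]]
    by (simp add: x_def)
  interpret maximal_edge_colouring fun_scale "coord_space {..<m} :: (nat \<Rightarrow> 'k) set" V F i1 i2 ..
  have "int (CARD('k) - 1) = int (CARD('k)) - 1"
    by (simp add: of_nat_diff Suc_leI)
  then show ?thesis
    using card_colourings_deleted
    by (simp add: poly_eq_card finite_vertices complex complex_deleted
        simplicial_complex_contract_faces finite_coord_space del: of_nat_diff)
qed

theorem complex_char_poly_deletion_contraction: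
  "complex_char_poly TYPE('k::{field,finite}) V F =
     complex_char_poly TYPE('k) V deleted
     - smult (int (CARD('k)) - 1)
         (complex_char_poly TYPE('k) (identify i1 i2 ` V) contracted)"
proof (rule poly_eqI_infinite)
  have "card {0, 1 :: 'k} \<le> CARD('k)" by (rule card_mono) auto
  then have "inj (\<lambda>m. int (CARD('k) ^ m))"
    by (auto intro!: injI simp: power_inject_exp simp del: of_nat_power)
  then show "infinite (range (\<lambda>m. int (CARD('k) ^ m)))"
    by (rule range_inj_infinite)
qed (auto simp: poly_deletion_contraction simp del: of_nat_power)

end

theorem mainTheorem2:
  fixes q l i1 i2 :: nat and F :: "nat set set" and e :: "nat set"
  assumes "primepow q"
    and "CARD('k::{field,finite}) = q"
    and "simplicial_complex {1..l} F"
    and "e = {i1, i2}"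
    and "e \<in> underlying_edges F"
    and "maximal_face F e"
  shows "complex_char_poly TYPE('k) {1..l} F =
           complex_char_poly TYPE('k) {1..l} (delete_face F e)
           - smult (int q - 1)
               (complex_char_poly TYPE('k) (identify i1 i2 ` {1..l}) (contract_faces i1 i2 F))"
proof -
  interpret maximal_edge "{1..l}" F i1 i2
  proof
    show "i1 \<noteq> i2" using assms(4,5) by (auto simp: underlying_edges_def)
  qed (use assms in auto)
  show ?thesis
    using complex_char_poly_deletion_contraction[where 'k = 'k] assms(2,4) by simp
qed

end
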